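(* Let $f\colon A\to B$ be a surjective morphism of racks (or of quandles). Then $C_1(f)=[\mathrm{Eq}(f),A\times A]$. In particular, $f$ is a covering if and only if $[\mathrm{Eq}(f),A\times A]=\Delta_A$, the diagonal relation on $A$.
   Context: A rack is a set $A$ with binary operations $\triangleleft,\triangleleft^{-1}$ such that $(x\triangleleft a)\triangleleft^{-1}a=x=(x\triangleleft^{-1}a)\triangleleft a$ and $(x\triangleleft a)\triangleleft b=(x\triangleleft b)\triangleleft(a\triangleleft b)$ for all $x,a,b\in A$. A quandle is a rack with $a\triangleleft a=a$ for all $a$. Morphisms are functions preserving $\triangleleft$. Unbracketed expressions are evaluated from left to right. $\mathrm{Eq}(f)=\{(a,b)\mid f(a)=f(b)\}$. A surjective morphism $f\colon A\to B$ is a covering if $x\triangleleft a=x\triangleleft b$ for all $x,a,b\in A$ with $f(a)=f(b)$. $C_1(f)$ is the congruence on $A$ generated by the pairs $(x\triangleleft a\triangleleft^{-1}b,\ x)$ with $x,a,b\in A$ and $f(a)=f(b)$. For congruences $R,S$ on a rack $A$, $R\,\square\,S$ is the set of $(a,b,c,d)\in A^4$ with $(a,b),(d,c)\in R$ and $(a,d),(b,c)\in S$, and $[R,S]$ is the congruence on $A$ generated by the pairs $(x\triangleleft a\triangleleft^{-1}b\triangleleft c\triangleleft^{-1}d,\ x)$ with $x\in A$, $(a,b,c,d)\in R\,\square\,S$. $A\times A$ denotes the largest congruence. *)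

theory Defs
  imports "HOL-Algebra.Congruence"
begin

section \<open>Racks and quandles\<close>

record 'a rack_struct = "'a partial_object" +
  rack_op :: "'a \<Rightarrow> 'a \<Rightarrow> 'a" (infixl \<open>\<lhd>\<index>\<close> 70)
  rack_inv :: "'a \<Rightarrow> 'a \<Rightarrow> 'a" (infixl \<open>\<lhd>\<inverse>\<index>\<close> 70)

locale rack =
  fixes A :: "('a, 'm) rack_struct_scheme" (structure)
  assumes op_closed [simp, intro]:
      "\<lbrakk> x \<in> carrier A; a \<in> carrier A \<rbrakk> \<Longrightarrow> x \<lhd> a \<in> carrier A"
    and inv_closed [simp, intro]:
      "\<lbrakk> x \<in> carrier A; a \<in> carrier A \<rbrakk> \<Longrightarrow> x \<lhd>\<inverse> a \<in> carrier A"
    and inv_op [simp]: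
      "\<lbrakk> x \<in> carrier A; a \<in> carrier A \<rbrakk> \<Longrightarrow> x \<lhd> a \<lhd>\<inverse> a = x"
    and op_inv [simp]:
      "\<lbrakk> x \<in> carrier A; a \<in> carrier A \<rbrakk> \<Longrightarrow> x \<lhd>\<inverse> a \<lhd> a = x"
    and self_distrib:
      "\<lbrakk> x \<in> carrier A; a \<in> carrier A; b \<in> carrier A \<rbrakk> \<Longrightarrow>
        x \<lhd> a \<lhd> b = (x \<lhd> b) \<lhd> (a \<lhd> b)"

locale quandle = rack +
  assumes idem [simp]: "a \<in> carrier A \<Longrightarrow> a \<lhd> a = a"

definition rack_hom ::
    "('a, 'm) rack_struct_scheme \<Rightarrow> ('b, 'n) rack_struct_scheme \<Rightarrow> ('a \<Rightarrow> 'b) set" where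
  "rack_hom A B = {f \<in> carrier A \<rightarrow> carrier B.
     \<forall>x\<in>carrier A. \<forall>y\<in>carrier A. f (x \<lhd>\<^bsub>A\<^esub> y) = f x \<lhd>\<^bsub>B\<^esub> f y}"

definition rack_epi ::
    "('a, 'm) rack_struct_scheme \<Rightarrow> ('b, 'n) rack_struct_scheme \<Rightarrow> ('a \<Rightarrow> 'b) set" where
  "rack_epi A B = {f \<in> rack_hom A B. f ` carrier A = carrier B}"

definition covering ::
    "('a, 'm) rack_struct_scheme \<Rightarrow> ('b, 'n) rack_struct_scheme \<Rightarrow> ('a \<Rightarrow> 'b) \<Rightarrow> bool" where
  "covering A B f \<longleftrightarrow> f \<in> rack_epi A B \<and>
     (\<forall>x\<in>carrier A. \<forall>a\<in>carrier A. \<forall>b\<in>carrier A.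
        f a = f b \<longrightarrow> x \<lhd>\<^bsub>A\<^esub> a = x \<lhd>\<^bsub>A\<^esub> b)"


section \<open>Congruences\<close>

text \<open>
  Compatibility is required for both operations. A quotient of a quandle by such a congruence
  is again a quandle, so congruences on a quandle are just those on its underlying rack.
\<close>

definition rack_congruence :: "('a, 'm) rack_struct_scheme \<Rightarrow> ('a \<times> 'a) set \<Rightarrow> bool" where
  "rack_congruence A R \<longleftrightarrow> equiv (carrier A) R \<and>
     (\<forall>x y a b. (x, y) \<in> R \<longrightarrow> (a, b) \<in> R \<longrightarrow>
        (x \<lhd>\<^bsub>A\<^esub> a, y \<lhd>\<^bsub>A\<^esub> b) \<in> R \<and> (x \<lhd>\<inverse>\<^bsub>A\<^esub> a, y \<lhd>\<inverse>\<^bsub>A\<^esub> b) \<in> R)"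

text \<open>Intended for \<open>P \<subseteq> carrier A \<times> carrier A\<close>, so that the intersection is not over an empty family.\<close>

definition cong_gen ::
    "('a, 'm) rack_struct_scheme \<Rightarrow> ('a \<times> 'a) set \<Rightarrow> ('a \<times> 'a) set" where
  "cong_gen A P = \<Inter>{R. rack_congruence A R \<and> P \<subseteq> R}"

definition Eq ::
    "('a, 'm) rack_struct_scheme \<Rightarrow> ('a \<Rightarrow> 'b) \<Rightarrow> ('a \<times> 'a) set" where
  "Eq A f = {(a, b). a \<in> carrier A \<and> b \<in> carrier A \<and> f a = f b}"

definition C1 ::
    "('a, 'm) rack_struct_scheme \<Rightarrow> ('a \<Rightarrow> 'b) \<Rightarrow> ('a \<times> 'a) set" where
  "C1 A f = cong_gen A
     {(x \<lhd>\<^bsub>A\<^esub> a \<lhd>\<inverse>\<^bsub>A\<^esub> b, x) | x a b.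
        x \<in> carrier A \<and> a \<in> carrier A \<and> b \<in> carrier A \<and> f a = f b}"

definition box_rel ::
    "('a \<times> 'a) set \<Rightarrow> ('a \<times> 'a) set \<Rightarrow> ('a \<times> 'a \<times> 'a \<times> 'a) set" (infixl \<open>\<box>\<close> 70) where
  "R \<box> S = {(a, b, c, d). (a, b) \<in> R \<and> (d, c) \<in> R \<and> (a, d) \<in> S \<and> (b, c) \<in> S}"

definition commutator ::
    "('a, 'm) rack_struct_scheme \<Rightarrow> ('a \<times> 'a) set \<Rightarrow> ('a \<times> 'a) set \<Rightarrow> ('a \<times> 'a) set" where
  "commutator A R S = cong_gen A
     {(x \<lhd>\<^bsub>A\<^esub> a \<lhd>\<inverse>\<^bsub>A\<^esub> b \<lhd>\<^bsub>A\<^esub> c \<lhd>\<inverse>\<^bsub>A\<^esub> d, x) | x a b c d.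
        x \<in> carrier A \<and> (a, b, c, d) \<in> R \<box> S}"


section \<open>Basic facts\<close>

context rack
begin

lemma rack_congruence_full: "rack_congruence A (carrier A \<times> carrier A)"
  by (auto simp: rack_congruence_def equiv_def refl_on_def sym_def trans_def)

lemma rack_congruence_cong_gen:
  assumes "P \<subseteq> carrier A \<times> carrier A"
  shows "rack_congruence A (cong_gen A P)"
proof -
  have sub: "cong_gen A P \<subseteq> carrier A \<times> carrier A"
    unfolding cong_gen_def using assms rack_congruence_full by blast
  have cong: "p \<in> R"
    if "p \<in> cong_gen A P" "rack_congruence A R" "P \<subseteq> R" for p R
    using that by (auto simp: cong_gen_def)
  have "refl_on (carrier A) (cong_gen A P)"
    by (auto simp: cong_gen_def rack_congruence_def equiv_def refl_on_def)
  moreover have "sym (cong_gen A P)"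
  proof (rule symI)
    fix x y assume "(x, y) \<in> cong_gen A P"
    then show "(y, x) \<in> cong_gen A P"
      unfolding cong_gen_def rack_congruence_def equiv_def by (blast dest: symD)
  qed
  moreover have "trans (cong_gen A P)"
  proof (rule transI)
    fix x y z assume xy: "(x, y) \<in> cong_gen A P" and yz: "(y, z) \<in> cong_gen A P"
    have "(x, z) \<in> R" if R: "rack_congruence A R" "P \<subseteq> R" for R
    proof -
      have "trans R"
        using R(1) by (simp add: rack_congruence_def equiv_def)
      then show ?thesis
        using cong[OF xy R] cong[OF yz R] by (rule transD)
    qed
    then show "(x, z) \<in> cong_gen A P"
      by (simp add: cong_gen_def)
  qed
  moreover have "(x \<lhd> a, y \<lhd> b) \<in> cong_gen A P \<and> (x \<lhd>\<inverse> a, y \<lhd>\<inverse> b) \<in> cong_gen A P"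
    if xy: "(x, y) \<in> cong_gen A P" and ab: "(a, b) \<in> cong_gen A P" for x y a b
  proof -
    have "(x \<lhd> a, y \<lhd> b) \<in> R \<and> (x \<lhd>\<inverse> a, y \<lhd>\<inverse> b) \<in> R"
      if R: "rack_congruence A R" "P \<subseteq> R" for R
      using R(1) cong[OF xy R] cong[OF ab R] unfolding rack_congruence_def by blast
    then show ?thesis
      by (simp add: cong_gen_def)
  qed
  ultimately show ?thesis
    using sub unfolding rack_congruence_def equiv_def by blast
qed

lemma rack_congruence_Eq:
  assumes "rack B" and "f \<in> rack_hom A B"
  shows "rack_congruence A (Eq A f)"
proof -
  interpret B: rack B by fact
  have f_in: "f x \<in> carrier B" if "x \<in> carrier A" for x
    using assms(2) that by (auto simp: rack_hom_def)
  have f_op: "f (x \<lhd> y) = f x \<lhd>\<^bsub>B\<^esub> f y" if "x \<in> carrier A" "y \<in> carrier A" for x y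
    using assms(2) that by (auto simp: rack_hom_def)
  have f_inv: "f (x \<lhd>\<inverse> y) = f x \<lhd>\<inverse>\<^bsub>B\<^esub> f y" if "x \<in> carrier A" "y \<in> carrier A" for x y
  proof -
    have "f (x \<lhd>\<inverse> y) = f (x \<lhd>\<inverse> y) \<lhd>\<^bsub>B\<^esub> f y \<lhd>\<inverse>\<^bsub>B\<^esub> f y"
      using that f_in by simp
    also have "f (x \<lhd>\<inverse> y) \<lhd>\<^bsub>B\<^esub> f y = f x"
      using that by (simp flip: f_op)
    finally show ?thesis .
  qed
  show ?thesis
    by (auto simp: rack_congruence_def Eq_def equiv_def refl_on_def sym_def trans_def f_op f_inv)
qed

end

lemma cong_gen_superset: "P \<subseteq> cong_gen A P"
  by (auto simp: cong_gen_def)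

lemma cong_gen_least: "rack_congruence A R \<Longrightarrow> P \<subseteq> R \<Longrightarrow> cong_gen A P \<subseteq> R"
  by (auto simp: cong_gen_def)

end

theory Submission
  imports Defs
begin

text \<open>
  When the second congruence is the largest one, its two conditions on a square \<open>(a, b, c, d)\<close>
  are empty, so that \<open>(a, b)\<close> and \<open>(d, c)\<close> are two unrelated pairs of the first congruence \<open>R\<close>.
  A generator of \<open>[R, A \<times> A]\<close> thus moves \<open>x\<close> by two successive moves of the kind
  \<open>x \<mapsto> x \<lhd> a \<lhd>\<inverse> b\<close> with \<open>(a, b) \<in> R\<close>. The second one is trivial for \<open>c = d\<close>, and so
  single moves and double moves generate the same congruence; this is
  \<open>commutator_full_eq_cong_gen\<close>, which for \<open>R = Eq(f)\<close> gives the first claim.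

  For the second claim, \<open>C\<^sub>1(f)\<close> is the diagonal exactly if all its generators lie on the diagonal,
  and by right cancellation of \<open>b\<close>, the equation \<open>x \<lhd> a \<lhd>\<inverse> b = x\<close> says \<open>x \<lhd> a = x \<lhd> b\<close>.
\<close>

context rack
begin

lemma rack_congruence_Id_on: "rack_congruence A (Id_on (carrier A))"
  by (auto simp: rack_congruence_def equiv_def refl_on_def sym_def trans_def)

lemma cong_gen_eq_Id_on_iff:
  assumes "P \<subseteq> carrier A \<times> carrier A"
  shows "cong_gen A P = Id_on (carrier A) \<longleftrightarrow> P \<subseteq> Id_on (carrier A)"
proof
  assume "cong_gen A P = Id_on (carrier A)"
  then show "P \<subseteq> Id_on (carrier A)"
    using cong_gen_superset[of P A] by simp
next
  assume "P \<subseteq> Id_on (carrier A)"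
  then have "cong_gen A P \<subseteq> Id_on (carrier A)"
    by (rule cong_gen_least[OF rack_congruence_Id_on])
  moreover have "Id_on (carrier A) \<subseteq> cong_gen A P"
    using rack_congruence_cong_gen[OF assms]
    by (auto simp: rack_congruence_def equiv_def refl_on_def)
  ultimately show "cong_gen A P = Id_on (carrier A)" ..
qed

lemma op_inv_eq_iff:
  assumes "x \<in> carrier A" "a \<in> carrier A" "b \<in> carrier A"
  shows "x \<lhd> a \<lhd>\<inverse> b = x \<longleftrightarrow> x \<lhd> a = x \<lhd> b"
  using assms by (metis inv_op op_closed op_inv)

text \<open>
  Reflexivity of \<open>R\<close> provides the trivial second move that turns a single move into a double one.
  Conversely, symmetry of \<open>R\<close> makes \<open>x \<mapsto> x \<lhd> c \<lhd>\<inverse> d\<close> a single move, although the square only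
  provides \<open>(d, c) \<in> R\<close>, and transitivity of the generated congruence composes the two.
\<close>

lemma commutator_full_eq_cong_gen:
  assumes "equiv (carrier A) R"
  shows "commutator A R (carrier A \<times> carrier A) =
    cong_gen A {(x \<lhd> a \<lhd>\<inverse> b, x) | x a b. x \<in> carrier A \<and> (a, b) \<in> R}"
proof (rule equalityI)
  let ?P = "{(x \<lhd> a \<lhd>\<inverse> b, x) | x a b. x \<in> carrier A \<and> (a, b) \<in> R}"
  let ?Q = "{(x \<lhd> a \<lhd>\<inverse> b \<lhd> c \<lhd>\<inverse> d, x) | x a b c d.
    x \<in> carrier A \<and> (a, b, c, d) \<in> R \<box> (carrier A \<times> carrier A)}"
  have R_sub: "R \<subseteq> carrier A \<times> carrier A" and R_sym: "sym R"
    and R_refl: "\<And>a. a \<in> carrier A \<Longrightarrow> (a, a) \<in> R"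
    using assms by (auto simp: equiv_def refl_on_def)
  have P_cong: "rack_congruence A (cong_gen A ?P)"
    using R_sub by (intro rack_congruence_cong_gen) auto
  then have P_trans: "trans (cong_gen A ?P)"
    by (simp add: rack_congruence_def equiv_def)
  have move: "(x \<lhd> a \<lhd>\<inverse> b, x) \<in> cong_gen A ?P" if "x \<in> carrier A" "(a, b) \<in> R" for x a b
    using that by (intro subsetD[OF cong_gen_superset]) blast
  show "commutator A R (carrier A \<times> carrier A) \<subseteq> cong_gen A ?P"
    unfolding commutator_def
  proof (rule cong_gen_least[OF P_cong], rule subsetI)
    fix p assume "p \<in> ?Q"
    then obtain x a b c d where p: "p = (x \<lhd> a \<lhd>\<inverse> b \<lhd> c \<lhd>\<inverse> d, x)"
      and x: "x \<in> carrier A" and ab: "(a, b) \<in> R" and dc: "(d, c) \<in> R"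
      by (auto simp: box_rel_def)
    have "x \<lhd> a \<lhd>\<inverse> b \<in> carrier A"
      using x ab R_sub by auto
    moreover have "(c, d) \<in> R"
      using R_sym dc by (rule symD)
    ultimately have "(x \<lhd> a \<lhd>\<inverse> b \<lhd> c \<lhd>\<inverse> d, x \<lhd> a \<lhd>\<inverse> b) \<in> cong_gen A ?P"
      by (rule move)
    then show "p \<in> cong_gen A ?P"
      unfolding p using move[OF x ab] by (rule transD[OF P_trans])
  qed
  have "?P \<subseteq> ?Q"
  proof
    fix p assume "p \<in> ?P"
    then obtain x a b where p: "p = (x \<lhd> a \<lhd>\<inverse> b, x)" and x: "x \<in> carrier A" and ab: "(a, b) \<in> R"
      by auto
    then have a: "a \<in> carrier A" and b: "b \<in> carrier A"
      using R_sub by auto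
    \<comment> \<open>Any \<open>c = d\<close> completes \<open>(a, b)\<close> to a square with a trivial second move.\<close>
    have "(a, b, a, a) \<in> R \<box> (carrier A \<times> carrier A)"
      using ab a b R_refl by (simp add: box_rel_def)
    moreover have "p = (x \<lhd> a \<lhd>\<inverse> b \<lhd> a \<lhd>\<inverse> a, x)"
      using p x a b by simp
    ultimately show "p \<in> ?Q"
      using x by blast
  qed
  also have "?Q \<subseteq> commutator A R (carrier A \<times> carrier A)"
    unfolding commutator_def by (rule cong_gen_superset)
  finally have "?P \<subseteq> commutator A R (carrier A \<times> carrier A)" .
  moreover have "rack_congruence A (commutator A R (carrier A \<times> carrier A))"
    unfolding commutator_def using R_sub
    by (intro rack_congruence_cong_gen) (auto simp: box_rel_def)
  ultimately show "cong_gen A ?P \<subseteq> commutator A R (carrier A \<times> carrier A)"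
    by (intro cong_gen_least)
qed

lemma equiv_Eq: "equiv (carrier A) (Eq A f)"
  by (auto simp: Eq_def equiv_def refl_on_def sym_def trans_def)

lemma C1_eq_commutator: "C1 A f = commutator A (Eq A f) (carrier A \<times> carrier A)"
  unfolding commutator_full_eq_cong_gen[OF equiv_Eq] by (simp add: C1_def Eq_def)

lemma covering_iff_C1_eq_Id_on:
  assumes "f \<in> rack_epi A B"
  shows "covering A B f \<longleftrightarrow> C1 A f = Id_on (carrier A)"
proof -
  let ?P = "{(x \<lhd> a \<lhd>\<inverse> b, x) | x a b.
    x \<in> carrier A \<and> a \<in> carrier A \<and> b \<in> carrier A \<and> f a = f b}"
  have "C1 A f = Id_on (carrier A) \<longleftrightarrow> ?P \<subseteq> Id_on (carrier A)"
    unfolding C1_def by (rule cong_gen_eq_Id_on_iff) auto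
  also have "\<dots> \<longleftrightarrow> (\<forall>x\<in>carrier A. \<forall>a\<in>carrier A. \<forall>b\<in>carrier A.
      f a = f b \<longrightarrow> x \<lhd> a \<lhd>\<inverse> b = x)"
  proof
    assume P: "?P \<subseteq> Id_on (carrier A)"
    show "\<forall>x\<in>carrier A. \<forall>a\<in>carrier A. \<forall>b\<in>carrier A.
      f a = f b \<longrightarrow> x \<lhd> a \<lhd>\<inverse> b = x"
    proof (intro ballI impI)
      fix x a b
      assume "x \<in> carrier A" "a \<in> carrier A" "b \<in> carrier A" "f a = f b"
      then have "(x \<lhd> a \<lhd>\<inverse> b, x) \<in> ?P"
        by blast
      then have "(x \<lhd> a \<lhd>\<inverse> b, x) \<in> Id_on (carrier A)"
        by (rule subsetD[OF P])
      then show "x \<lhd> a \<lhd>\<inverse> b = x"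
        by (simp add: Id_on_iff)
    qed
  qed auto
  also have "\<dots> \<longleftrightarrow> covering A B f"
    using assms by (simp add: covering_def op_inv_eq_iff)
  finally show ?thesis ..
qed

end

theorem corollary3p1p7:
  fixes A :: "('a, 'm) rack_struct_scheme"
    and B :: "('b, 'n) rack_struct_scheme"
    and f :: "'a \<Rightarrow> 'b"
  assumes "(rack A \<and> rack B) \<or> (quandle A \<and> quandle B)"
    and "f \<in> rack_epi A B"
  shows "C1 A f = commutator A (Eq A f) (carrier A \<times> carrier A) \<and>
    (covering A B f \<longleftrightarrow>
       commutator A (Eq A f) (carrier A \<times> carrier A) = Id_on (carrier A))"
proof -
  interpret rack A
    using assms(1) quandle.axioms(1) by blast
  show ?thesis
    by (simp add: covering_iff_C1_eq_Id_on[OF assms(2)] C1_eq_commutator)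
qed

end
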